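(* Let $a,b,c,d,e,f,u,v,w,x,y,z$ be twelve distinct spin orbitals, and let $\eta_1,\eta_2$ be two further distinct (ancilla) spin orbitals. Let $\theta\in\mathbb{R}$. Let $$\ket{\Psi}=\xi_1\ket{abcdef}+\xi_2\ket{ab\phi_1\phi_2\phi_3\phi_4}+\xi_3\ket{cdef\phi_5\phi_6}+\xi_4\ket{uvwxyz},$$ where $\xi_1,\dots,\xi_4$ are arbitrary coefficients and $\phi_1,\dots,\phi_6$ are orbitals not in $\{a,b,c,d,e,f,u,v,w,x,y,z,\eta_1,\eta_2\}$, with $\phi_1,\dots,\phi_4$ distinct and $\phi_5\neq\phi_6$ (so the ancilla orbitals are empty in $\ket{\Psi}$). Then two doubles, two quadruples and one quadruply controlled double reproduce the sextuple unitary coupled-cluster factor on $\ket{\Psi}$: $$U^{ab}_{u\eta_1}(\tfrac{\pi}{2})\,U^{cdef}_{wxy\eta_2}(\tfrac{\pi}{2})\,C_{uwxy}U^{vz}_{\eta_1\eta_2}(\theta)\,U^{wxy\eta_2}_{cdef}(\tfrac{\pi}{2})\,U^{u\eta_1}_{ab}(\tfrac{\pi}{2})\ket{\Psi}=e^{\theta\left(\hat A_{abcdef}^{uvwxyz}-(\hat A_{abcdef}^{uvwxyz})^\dagger\right)}\ket{\Psi},$$ and both sides equal $$\xi_1(\cos\theta\ket{abcdef}+\sin\theta\ket{uvwxyz})+\xi_2\ket{ab\phi_1\phi_2\phi_3\phi_4}+\xi_3\ket{cdef\phi_5\phi_6}+\xi_4(\cos\theta\ket{uvwxyz}-\sin\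theta\ket{abcdef}).$$
   Context: Work in the fermionic Fock space over a finite set of spin orbitals with creation and annihilation operators $\hat a_p^\dagger,\hat a_p$ satisfying $\{\hat a_p,\hat a_q\}=0$, $\{\hat a_p^\dagger,\hat a_q^\dagger\}=0$, $\{\hat a_p,\hat a_q^\dagger\}=\delta_{pq}$, vacuum $\ket{\mathrm{vac}}$ and number operators $\hat n_p=\hat a_p^\dagger\hat a_p$. A ket listing orbitals denotes the determinant $\ket{p_1p_2\cdots p_m}=\hat a_{p_1}^\dagger\hat a_{p_2}^\dagger\cdots\hat a_{p_m}^\dagger\ket{\mathrm{vac}}$; all orbitals not listed are empty. For disjoint lists of distinct orbitals $i_1,\dots,i_n$ and $p_1,\dots,p_n$, the rank-$n$ excitation operator is $\hat A_{i_1\cdots i_n}^{p_1\cdots p_n}=\hat a_{p_1}^\dagger\hat a_{p_2}^\dagger\cdots\hat a_{p_n}^\dagger\,\hat a_{i_n}\cdots\hat a_{i_2}\hat a_{i_1}$. The corresponding unitary coupled-cluster (UCC) factor with angle $\theta$ is $U_{i_1\cdots i_n}^{p_1\cdots p_n}(\theta)=\exp\!\big(\theta[\hat A_{i_1\cdots i_n}^{p_1\cdots p_n}-(\hat A_{i_1\cdots i_n}^{p_1\cdots p_n})^\dagger]\big)$. The controlled factor $C_{q_1\cdots q_k}U_{i_1\cdots i_n}^{p_1\cdots p_n}(\theta)$, with control orbitals $q_1,\dots,q_k$ distinct from all $i$'s and $p$'s, acts as $U_{i_1\cdots i_n}^{p_1\cdots p_n}(\theta)$ on determinants in which all of $q_1,\dots,q_k$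 are occupied, and as the identity on all other determinants; equivalently it is $\exp\!\big(\theta\,\hat n_{q_1}\cdots\hat n_{q_k}[\hat A_{i_1\cdots i_n}^{p_1\cdots p_n}-(\hat A_{i_1\cdots i_n}^{p_1\cdots p_n})^\dagger]\big)$. *)

theory Defs
  imports "HOL-Analysis.Analysis"
begin

(* The fermionic Fock space over the finite set of spin orbitals 'o, written in the occupation
   number basis: axis S 1 is the Slater determinant whose occupied orbitals are the members of S,
   created in increasing order.  The linear order on 'o only fixes the signs of these basis vectors
   (Jordan-Wigner); the lemmas CAR_annih, CAR_create, CAR_mixed and annih_vac below show that the
   operators satisfy the canonical anticommutation relations.  Operators are matrices in this basis,
   composed by ** and applied by *v. *)

type_synonym 'o fock = "(complex, 'o set) vec"
type_synonym 'o fock_op = "((complex, 'o set) vec, 'o set) vec"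

definition dagger :: "'o::finite fock_op \<Rightarrow> 'o fock_op" where
  "dagger A = (\<chi> T S. cnj (A $ S $ T))"

definition jw_sign :: "'o::{finite,linorder} \<Rightarrow> 'o set \<Rightarrow> complex" where
  "jw_sign p S = (- 1) ^ card {q \<in> S. q < p}"

definition annih :: "'o::{finite,linorder} \<Rightarrow> 'o fock_op" where
  "annih p = (\<chi> T S. if p \<in> S \<and> T = S - {p} then jw_sign p S else 0)"

definition create :: "'o::{finite,linorder} \<Rightarrow> 'o fock_op" where
  "create p = dagger (annih p)"

definition number :: "'o::{finite,linorder} \<Rightarrow> 'o fock_op" where
  "number p = create p ** annih p"

definition vac :: "'o::finite fock" where
  "vac = axis {} 1"

definition op_prod :: "'o::finite fock_op list \<Rightarrow> 'o fock_op" where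
  "op_prod As = foldr (**) As (mat 1)"

definition ket :: "'o::{finite,linorder} list \<Rightarrow> 'o fock" where
  "ket ps = op_prod (map create ps) *v vac"

(* The operation ^ on vectors is componentwise, so powers and the exponential of an operator have
   to be spelled out. *)
definition op_power :: "'o::finite fock_op \<Rightarrow> nat \<Rightarrow> 'o fock_op" where
  "op_power A n = op_prod (replicate n A)"

definition op_exp :: "'o::finite fock_op \<Rightarrow> 'o fock_op" where
  "op_exp A = (\<Sum>n. (1 / fact n) *\<^sub>R op_power A n)"

(* In excitation, ucc and cucc the list of annihilated (lower) orbitals precedes the list of
   created (upper) orbitals; cucc takes the control orbitals first. *)
definition excitation :: "'o::{finite,linorder} list \<Rightarrow> 'o list \<Rightarrow> 'o fock_op" where
  "excitation is ps = op_prod (map create ps) ** op_prod (map annih (rev is))"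

definition ucc :: "'o::{finite,linorder} list \<Rightarrow> 'o list \<Rightarrow> real \<Rightarrow> 'o fock_op" where
  "ucc is ps \<theta> = op_exp (\<theta> *\<^sub>R (excitation is ps - dagger (excitation is ps)))"

(* Given by its action on determinants, that is, column by column; cucc_eq_exp gives the
   exponential form. *)
definition cucc ::
    "'o::{finite,linorder} list \<Rightarrow> 'o list \<Rightarrow> 'o list \<Rightarrow> real \<Rightarrow> 'o fock_op" where
  "cucc qs is ps \<theta> =
     (\<chi> T S. if set qs \<subseteq> S then ucc is ps \<theta> $ T $ S else mat 1 $ T $ S)"


lemma axis_1_nth: "axis S 1 $ T = (if T = S then 1 else 0)"
  by (auto simp: axis_def)

lemma mult_axis_nth:
  fixes A :: "complex ^ 'n::finite ^ 'm::finite"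
  shows "(A *v axis S 1) $ T = A $ T $ S"
proof -
  have "(A *v axis S 1) $ T = (\<Sum>R\<in>UNIV. if S = R then A $ T $ R else 0)"
    unfolding matrix_vector_mult_def vec_lambda_beta by (intro sum.cong) (auto simp: axis_1_nth)
  then show ?thesis by simp
qed

lemma matrix_eqI_axis:
  fixes A B :: "complex ^ 'n::finite ^ 'm::finite"
  assumes "\<And>S. A *v axis S 1 = B *v axis S 1"
  shows "A = B"
  using assms by (metis mult_axis_nth vec_eq_iff)

lemma annih_axis:
  "annih p *v axis S 1 = (if p \<in> S then jw_sign p S *s axis (S - {p}) 1 else 0)"
  by (simp add: vec_eq_iff mult_axis_nth axis_1_nth annih_def)

lemma create_axis:
  "create p *v axis S 1 = (if p \<in> S then 0 else jw_sign p S *s axis (insert p S) 1)"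
proof -
  have "{q \<in> insert p S. q < p} = {q \<in> S. q < p}" by auto
  then have "jw_sign p (insert p S) = jw_sign p S" by (simp add: jw_sign_def)
  moreover have "p \<in> T \<and> S = T - {p} \<longleftrightarrow> p \<notin> S \<and> T = insert p S" for T by auto
  ultimately show ?thesis
    by (simp add: vec_eq_iff mult_axis_nth axis_1_nth annih_def create_def dagger_def)
      (auto simp: jw_sign_def)
qed

lemma jw_sign_insert:
  "p \<noteq> q \<Longrightarrow> q \<notin> S \<Longrightarrow> jw_sign p (insert q S) = (if q < p then - jw_sign p S else jw_sign p S)"
proof -
  assume "p \<noteq> q" "q \<notin> S"
  have "{r \<in> insert q S. r < p} = (if q < p then insert q {r \<in> S. r < p} else {r \<in> S. r < p})"
    by auto
  with \<open>q \<notin> S\<close> show ?thesis by (simp add: jw_sign_def)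
qed

lemma jw_sign_insert_self: "jw_sign p (insert p S) = jw_sign p S"
proof -
  have "{q \<in> insert p S. q < p} = {q \<in> S. q < p}" by auto
  then show ?thesis by (simp add: jw_sign_def)
qed

lemma jw_sign_Diff_self: "jw_sign p (S - {p}) = jw_sign p S"
  by (metis insert_Diff_single jw_sign_insert_self)

lemma jw_sign_Diff:
  "p \<noteq> q \<Longrightarrow> q \<in> S \<Longrightarrow> jw_sign p (S - {q}) = (if q < p then - jw_sign p S else jw_sign p S)"
  using jw_sign_insert[of p q "S - {q}"] by (simp add: insert_absorb)

lemma jw_sign_square: "jw_sign p S * jw_sign p S = 1"
  by (simp add: jw_sign_def flip: power_mult_distrib)

lemmas fock_simps = matrix_vector_mult_add_rdistrib vector_scalar_commute annih_axis create_axis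
  jw_sign_insert jw_sign_insert_self jw_sign_Diff jw_sign_Diff_self jw_sign_square

lemma CAR_annih: "annih p ** annih q + annih q ** annih p = 0"
proof (rule matrix_eqI_axis)
  fix S
  have *: "S - {q} - {p} = S - {p} - {q}" by auto
  show "(annih p ** annih q + annih q ** annih p) *v axis S 1 = 0 *v axis S 1"
    unfolding matrix_vector_mult_add_rdistrib
    by (cases p q rule: linorder_cases)
      (auto simp: fock_simps * vec_eq_iff simp flip: matrix_vector_mul_assoc)
qed

lemma dagger_mult: "dagger (A ** B) = dagger B ** dagger A"
  by (simp add: dagger_def vec_eq_iff matrix_matrix_mult_def mult.commute)

lemma dagger_dagger: "dagger (dagger A) = A"
  by (simp add: dagger_def vec_eq_iff)

lemma CAR_create: "create p ** create q + create q ** create p = 0"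
proof -
  have "create p ** create q + create q ** create p =
      dagger (annih q ** annih p + annih p ** annih q)"
    by (simp add: create_def dagger_def vec_eq_iff matrix_matrix_mult_def mult.commute)
  then show ?thesis by (simp add: CAR_annih dagger_def vec_eq_iff)
qed

lemma CAR_mixed: "annih p ** create q + create q ** annih p = (if p = q then mat 1 else 0)"
proof (rule matrix_eqI_axis)
  fix S
  have *: "insert q S - {p} = insert q (S - {p})" if "p \<noteq> q" using that by auto
  show "(annih p ** create q + create q ** annih p) *v axis S 1 =
      (if p = q then mat 1 else 0) *v axis S 1"
    unfolding matrix_vector_mult_add_rdistrib
    by (cases p q rule: linorder_cases)
      (auto simp: fock_simps * insert_absorb vec_eq_iff simp flip: matrix_vector_mul_assoc)
qed

lemma annih_vac: "annih p *v vac = 0"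
  by (simp add: vac_def annih_axis)

lemma ket_Nil: "ket [] = vac"
  by (simp add: ket_def op_prod_def)

lemma ket_Cons: "ket (p # ps) = create p *v ket ps"
  by (simp add: ket_def op_prod_def matrix_vector_mul_assoc)

lemma op_power_0: "op_power A 0 = mat 1"
  by (simp add: op_power_def op_prod_def)

lemma op_power_Suc: "op_power A (Suc n) = A ** op_power A n"
  by (simp add: op_power_def op_prod_def)

lemma op_exp_sums:
  fixes A :: "'o::finite fock_op"
  shows "(\<lambda>n. (1 / fact n) *\<^sub>R op_power A n) sums op_exp A"
proof -
  define c where "c = (\<Sum>T\<in>UNIV. \<Sum>S\<in>UNIV. norm (A $ T $ S))"
  have c: "(\<Sum>R\<in>UNIV. norm (A $ T $ R)) \<le> c" for T
    unfolding c_def by (rule member_le_sum) (auto intro: sum_nonneg)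
  have c0: "c \<ge> 0" unfolding c_def by (intro sum_nonneg) auto
  have bound: "norm (op_power A n $ T $ S) \<le> c ^ n" for n T S
  proof (induction n arbitrary: T)
    case 0
    then show ?case by (simp add: op_power_0 mat_def)
  next
    case (Suc n)
    have "norm (op_power A (Suc n) $ T $ S) \<le> (\<Sum>R\<in>UNIV. norm (A $ T $ R * op_power A n $ R $ S))"
      by (simp add: op_power_Suc matrix_matrix_mult_def norm_sum)
    also have "\<dots> \<le> (\<Sum>R\<in>UNIV. norm (A $ T $ R) * c ^ n)"
      by (intro sum_mono) (simp add: norm_mult Suc.IH mult_left_mono)
    also have "\<dots> = (\<Sum>R\<in>UNIV. norm (A $ T $ R)) * c ^ n" by (simp add: sum_distrib_right)
    also have "\<dots> \<le> c * c ^ n" using c c0 by (intro mult_right_mono) auto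
    finally show ?case by simp
  qed
  have summ: "summable (\<lambda>n. (1 / fact n) *\<^sub>R (op_power A n $ T $ S))" for T S
  proof (rule summable_comparison_test')
    show "summable (\<lambda>n. inverse (fact n) * c ^ n)" by (rule summable_exp)
    show "norm ((1 / fact n) *\<^sub>R (op_power A n $ T $ S)) \<le> inverse (fact n) * c ^ n" for n
      by (simp add: bound divide_simps)
  qed
  have "(\<lambda>n. (1 / fact n) *\<^sub>R op_power A n) sums
      (\<chi> T S. \<Sum>n. (1 / fact n) *\<^sub>R (op_power A n $ T $ S))"
    unfolding sums_def
    by (intro vec_tendstoI)
      (use summ in \<open>simp add: summable_LIMSEQ\<close>)
  then show ?thesis unfolding op_exp_def using summable_sums sums_summable by blast
qed

lemma op_exp_nth:
  "(\<lambda>n. (1 / fact n) *\<^sub>R (op_power A n $ T $ S)) sums (op_exp A $ T $ S)"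
  using tendsto_vec_nth[OF tendsto_vec_nth[OF op_exp_sums[unfolded sums_def]], of A T S]
  by (simp add: sums_def)

lemma number_prod:
  "op_prod (map number qs) = (\<chi> T S. if T = S \<and> set qs \<subseteq> S then 1 else 0)"
proof -
  have "op_prod (map number qs) *v axis S 1 = (if set qs \<subseteq> S then axis S 1 else 0)" for S
    by (induction qs)
      (auto simp: op_prod_def number_def fock_simps insert_absorb
        simp flip: matrix_vector_mul_assoc)
  then have "op_prod (map number qs) $ T $ S = (if set qs \<subseteq> S then axis S 1 else 0) $ T" for T S
    using mult_axis_nth[of "op_prod (map number qs)" S T] by simp
  then show ?thesis by (auto simp: vec_eq_iff axis_1_nth)
qed

definition preserves_occ :: "'o::finite set \<Rightarrow> 'o fock_op \<Rightarrow> bool" where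
  "preserves_occ Q A \<longleftrightarrow> (\<forall>T S. A $ T $ S \<noteq> 0 \<longrightarrow> (Q \<subseteq> T \<longleftrightarrow> Q \<subseteq> S))"

lemma preserves_occ_mult:
  assumes "preserves_occ Q A" "preserves_occ Q B"
  shows "preserves_occ Q (A ** B)"
  unfolding preserves_occ_def
proof (intro allI impI)
  fix T S assume "(A ** B) $ T $ S \<noteq> 0"
  then obtain R where "A $ T $ R * B $ R $ S \<noteq> 0"
    unfolding matrix_matrix_mult_def by (auto elim: sum.not_neutral_contains_not_neutral)
  with assms show "Q \<subseteq> T \<longleftrightarrow> Q \<subseteq> S" unfolding preserves_occ_def by (metis mult_eq_0_iff)
qed

lemma preserves_occ_prod: "(\<And>A. A \<in> set As \<Longrightarrow> preserves_occ Q A) \<Longrightarrow> preserves_occ Q (op_prod As)"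
proof (induction As)
  case Nil
  then show ?case by (auto simp: op_prod_def preserves_occ_def mat_def)
next
  case (Cons A As)
  then show ?case using preserves_occ_mult[of Q A "op_prod As"] by (simp add: op_prod_def)
qed

lemma preserves_occ_dagger: "preserves_occ Q A \<Longrightarrow> preserves_occ Q (dagger A)"
  by (auto simp: preserves_occ_def dagger_def)

lemma preserves_occ_diff:
  assumes "preserves_occ Q A" "preserves_occ Q B"
  shows "preserves_occ Q (A - B)"
  unfolding preserves_occ_def
proof (intro allI impI)
  fix T S assume "(A - B) $ T $ S \<noteq> 0"
  then have "A $ T $ S \<noteq> 0 \<or> B $ T $ S \<noteq> 0" by auto
  with assms show "Q \<subseteq> T \<longleftrightarrow> Q \<subseteq> S" unfolding preserves_occ_def by blast
qed

lemma preserves_occ_annih: "p \<notin> Q \<Longrightarrow> preserves_occ Q (annih p)"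
  by (auto simp: preserves_occ_def annih_def)

lemma preserves_occ_excitation:
  assumes "Q \<inter> (set is \<union> set ps) = {}"
  shows "preserves_occ Q (excitation is ps)"
  unfolding excitation_def
  by (intro preserves_occ_mult preserves_occ_prod)
    (use assms in \<open>auto simp: create_def intro!: preserves_occ_dagger preserves_occ_annih\<close>)

lemma cucc_eq_exp:
  assumes "set qs \<inter> (set is \<union> set ps) = {}"
  shows "cucc qs is ps \<theta> =
    op_exp (\<theta> *\<^sub>R (op_prod (map number qs) ** (excitation is ps - dagger (excitation is ps))))"
proof -
  let ?K = "\<theta> *\<^sub>R (excitation is ps - dagger (excitation is ps))"
  let ?N = "\<theta> *\<^sub>R (op_prod (map number qs) ** (excitation is ps - dagger (excitation is ps)))"
  have K: "preserves_occ (set qs) ?K"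
    using preserves_occ_diff[OF preserves_occ_excitation preserves_occ_dagger, OF assms
        preserves_occ_excitation, OF assms]
    by (auto simp: preserves_occ_def)
  have N: "?N $ T $ S = (if set qs \<subseteq> T then ?K $ T $ S else 0)" for T S
  proof -
    have "(op_prod (map number qs) ** B) $ T $ S = (if set qs \<subseteq> T then B $ T $ S else 0)"
      for B :: "'a fock_op"
    proof -
      have "(op_prod (map number qs) ** B) $ T $ S =
          (\<Sum>R\<in>UNIV. if T = R then (if set qs \<subseteq> R then B $ R $ S else 0) else 0)"
        unfolding number_prod matrix_matrix_mult_def vec_lambda_beta
        by (intro sum.cong) auto
      then show ?thesis by simp
    qed
    then show ?thesis by simp
  qed
  have pow: "op_power ?N n $ T $ S =
      (if set qs \<subseteq> S then op_power ?K n $ T $ S else if n = 0 then mat 1 $ T $ S else 0)"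
    for n T S
  proof (induction n arbitrary: T)
    case 0
    then show ?case by (simp add: op_power_0)
  next
    case (Suc n)
    have powK: "preserves_occ (set qs) (op_power ?K m)" for m
      unfolding op_power_def by (rule preserves_occ_prod) (use K in auto)
    have eq: "op_power ?N (Suc n) $ T $ S = (\<Sum>R\<in>UNIV. ?N $ T $ R * op_power ?N n $ R $ S)"
      by (simp only: op_power_Suc matrix_matrix_mult_def vec_lambda_beta)
    show ?case
    proof (cases "set qs \<subseteq> S")
      case True
      have "op_power ?N (Suc n) $ T $ S =
          (if set qs \<subseteq> T then op_power ?K (Suc n) $ T $ S else 0)"
        unfolding eq N Suc.IH using True
        by (simp only: if_True op_power_Suc matrix_matrix_mult_def vec_lambda_beta) simp
      then show ?thesis using powK[of "Suc n"] True unfolding preserves_occ_def by metis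
    next
      case False
      have "?N $ T $ R * op_power ?N n $ R $ S = 0" for R
        unfolding N Suc.IH using False K unfolding preserves_occ_def mat_def
        by (cases "R = S") auto
      then have "op_power ?N (Suc n) $ T $ S = 0" unfolding eq by (intro sum.neutral) blast
      then show ?thesis using False by simp
    qed
  qed
  have "cucc qs is ps \<theta> $ T $ S = op_exp ?N $ T $ S" for T S
  proof (cases "set qs \<subseteq> S")
    case True
    then have "(\<lambda>n. (1 / fact n) *\<^sub>R (op_power ?K n $ T $ S)) sums (op_exp ?N $ T $ S)"
      using op_exp_nth[of ?N T S] by (simp only: pow if_True)
    moreover have "(\<lambda>n. (1 / fact n) *\<^sub>R (op_power ?K n $ T $ S)) sums (op_exp ?K $ T $ S)"
      by (rule op_exp_nth)
    ultimately show ?thesis using True by (simp add: cucc_def ucc_def sums_unique2)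
  next
    case False
    have "(\<lambda>n. (1 / fact n) *\<^sub>R (op_power ?N n $ T $ S)) =
        (\<lambda>n. if n = 0 then mat 1 $ T $ S else 0)"
      unfolding pow using False by auto
    then have "(\<lambda>n. if n = 0 then mat 1 $ T $ S else 0) sums (op_exp ?N $ T $ S)"
      using op_exp_nth[of ?N T S] by simp
    then have "op_exp ?N $ T $ S = mat 1 $ T $ S"
      using sums_single[of 0 "\<lambda>_. mat 1 $ T $ S :: complex"] sums_unique2 by fastforce
    then show ?thesis using False by (simp add: cucc_def)
  qed
  then show ?thesis by (simp add: vec_eq_iff)
qed

end

theory Submission
  imports Defs
begin

text \<open>
  An excitation operator \<open>A\<close> with lower orbitals \<open>is\<close> and upper orbitals \<open>ps\<close>, and its adjoint, which
  is the excitation from \<open>ps\<close> to \<open>is\<close>, exchange the determinants \<open>|is rs\<rangle>\<close> and \<open>|ps rs\<rangle>\<close>, and both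
  annihilate every determinant in which an orbital of \<open>is\<close> and an orbital of \<open>ps\<close> are empty.  So
  \<open>exp (\<theta> (A - A\<^sup>\<dagger>))\<close> rotates the plane of the former two and fixes the latter.  The two factors of
  angle \<open>\<pi>/2\<close> acting first carry \<open>|abcdef\<rangle>\<close> to \<open>|u\<eta>\<^sub>1wxy\<eta>\<^sub>2\<rangle>\<close> and fix \<open>|uvwxyz\<rangle>\<close>; the controlled
  double rotates these two into each other, and the last two factors undo the first two.  On the
  other two determinants the controls are not all occupied.
\<close>

section \<open>Exponentials of operators applied to vectors\<close>

lemma scaleR_eq_scalar_mult:
  fixes \<psi> :: "complex ^ 'n"
  shows "r *\<^sub>R \<psi> = complex_of_real r *s \<psi>"
  unfolding vec_eq_iff vector_scaleR_component vector_smult_component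
  by (simp only: scaleR_conv_of_real simp_thms)

lemma matrix_vector_mult_scaleR_left:
  fixes A :: "complex ^ 'n::finite ^ 'm::finite"
  shows "(r *\<^sub>R A) *v \<psi> = r *\<^sub>R (A *v \<psi>)"
  by (simp add: vec_eq_iff matrix_vector_mult_def scaleR_sum_right)

lemma matrix_vector_mult_scaleR_right:
  fixes A :: "complex ^ 'n::finite ^ 'm::finite"
  shows "A *v (r *\<^sub>R \<psi>) = r *\<^sub>R (A *v \<psi>)"
  by (simp add: scaleR_eq_scalar_mult vector_scalar_commute)

text \<open>In finite dimension, evaluating an operator at a fixed vector is bounded linear, so it
  passes through the exponential series.\<close>

lemma op_exp_mult_vec_sums:
  "(\<lambda>n. (1 / fact n) *\<^sub>R (op_power A n *v \<psi>)) sums (op_exp A *v \<psi>)"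
proof -
  have "linear (\<lambda>A::'a fock_op. A *v \<psi>)"
    by (intro linearI matrix_vector_mult_add_rdistrib matrix_vector_mult_scaleR_left)
  then have "bounded_linear (\<lambda>A::'a fock_op. A *v \<psi>)"
    by (simp add: linear_conv_bounded_linear)
  from bounded_linear.sums[OF this op_exp_sums] show ?thesis
    by (simp only: matrix_vector_mult_scaleR_left)
qed

text \<open>On the span of \<psi> and \<phi>, \<open>K\<close> is a quarter turn with square -1. The
  even terms of the series therefore collect to the cosine and the odd terms to the sine.\<close>

lemma op_exp_rotation:
  assumes "K *v \<psi> = \<phi>" and "K *v \<phi> = - \<psi>"
  shows "op_exp (\<theta> *\<^sub>R K) *v \<psi> = complex_of_real (cos \<theta>) *s \<psi> + complex_of_real (sin \<theta>) *s \<phi>"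
proof -
  have "(1 / fact n) *\<^sub>R (op_power (\<theta> *\<^sub>R K) n *v \<psi>) =
      (cos_coeff n *\<^sub>R \<theta> ^ n) *\<^sub>R \<psi> + (sin_coeff n *\<^sub>R \<theta> ^ n) *\<^sub>R \<phi>" for n
  proof (induction n)
    case 0
    then show ?case by (simp add: op_power_0)
  next
    case (Suc n)
    \<comment> \<open>One more factor of \<open>K\<close> exchanges the two coefficients up to sign,
      matching the recursions of \<open>cos_coeff\<close> and \<open>sin_coeff\<close>, both of
      which divide by \<open>Suc n\<close>.\<close>
    have "(1 / fact (Suc n)) *\<^sub>R (op_power (\<theta> *\<^sub>R K) (Suc n) *v \<psi>) =
        (\<theta> / real (Suc n)) *\<^sub>R (K *v ((1 / fact n) *\<^sub>R (op_power (\<theta> *\<^sub>R K) n *v \<psi>)))"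
      by (simp add: op_power_Suc matrix_vector_mult_scaleR_left matrix_vector_mult_scaleR_right
          mult.commute flip: matrix_vector_mul_assoc)
    also have "\<dots> = (\<theta> / real (Suc n)) *\<^sub>R
        ((cos_coeff n * \<theta> ^ n) *\<^sub>R \<phi> - (sin_coeff n * \<theta> ^ n) *\<^sub>R \<psi>)"
      unfolding Suc.IH
      by (simp add: matrix_vector_right_distrib matrix_vector_mult_scaleR_right assms)
    finally show ?case
      by (simp add: cos_coeff_Suc sin_coeff_Suc scaleR_diff_right mult_ac)
  qed
  then have "(\<lambda>n. (cos_coeff n *\<^sub>R \<theta> ^ n) *\<^sub>R \<psi> + (sin_coeff n *\<^sub>R \<theta> ^ n) *\<^sub>R \<phi>)
      sums (op_exp (\<theta> *\<^sub>R K) *v \<psi>)"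
    using op_exp_mult_vec_sums[of "\<theta> *\<^sub>R K" \<psi>] by simp
  moreover have "(\<lambda>n. (cos_coeff n *\<^sub>R \<theta> ^ n) *\<^sub>R \<psi> + (sin_coeff n *\<^sub>R \<theta> ^ n) *\<^sub>R \<phi>)
      sums (cos \<theta> *\<^sub>R \<psi> + sin \<theta> *\<^sub>R \<phi>)"
    by (intro sums_add sums_scaleR_left cos_converges sin_converges)
  ultimately show ?thesis
    unfolding scaleR_eq_scalar_mult by (rule sums_unique2)
qed

lemma op_exp_fixed:
  assumes "K *v \<psi> = 0"
  shows "op_exp (\<theta> *\<^sub>R K) *v \<psi> = \<psi>"
proof -
  have "op_power (\<theta> *\<^sub>R K) n *v \<psi> = (if n = 0 then \<psi> else 0)" for n
    by (induction n)
      (simp_all add: op_power_0 op_power_Suc matrix_vector_mult_scaleR_left assms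
        flip: matrix_vector_mul_assoc)
  then have "(\<lambda>n. if n = 0 then \<psi> else 0) sums (op_exp (\<theta> *\<^sub>R K) *v \<psi>)"
    using op_exp_mult_vec_sums[of "\<theta> *\<^sub>R K" \<psi>]
    by (simp add: if_distrib[of "scaleR _"] cong: if_cong)
  then show ?thesis
    using sums_single[of 0 "\<lambda>_. \<psi>"] sums_unique2 by fastforce
qed

section \<open>Excitation operators acting on determinants\<close>

lemma op_prod_Nil: "op_prod [] = mat 1"
  and op_prod_Cons: "op_prod (A # As) = A ** op_prod As"
  by (simp_all add: op_prod_def)

lemma op_prod_append: "op_prod (As @ Bs) = op_prod As ** op_prod Bs"
  by (induction As) (simp_all add: op_prod_Nil op_prod_Cons matrix_mul_assoc)

lemma dagger_op_prod: "dagger (op_prod As) = op_prod (map dagger (rev As))"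
proof (induction As)
  case Nil
  then show ?case by (simp add: op_prod_Nil dagger_def mat_def vec_eq_iff)
next
  case (Cons A As)
  then show ?case by (simp add: op_prod_Cons op_prod_Nil op_prod_append dagger_mult)
qed

lemma dagger_annih: "dagger (annih p) = create p"
  and dagger_create: "dagger (create p) = annih p"
  by (simp_all add: create_def dagger_dagger)

text \<open>Taking adjoints reverses both products, and the annihilators already stand in reversed
  order, so no sign appears. Facts about excitations thus cover both halves of a UCC
  generator.\<close>

lemma dagger_excitation: "dagger (excitation is ps) = excitation ps is"
  by (simp add: excitation_def dagger_mult dagger_op_prod rev_map comp_def
      dagger_annih dagger_create)

lemma annih_create: "annih p *v (create q *v \<psi>) = (if p = q then \<psi> else 0) - create q *v (annih p *v \<psi>)"
proof -
  have "annih p *v (create q *v \<psi>) + create q *v (annih p *v \<psi>) =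
      (if p = q then mat 1 else 0) *v \<psi>"
    by (simp only: CAR_mixed matrix_vector_mul_assoc flip: matrix_vector_mult_add_rdistrib)
  then show ?thesis by (auto simp: eq_diff_eq)
qed

lemma annih_annih: "annih p *v (annih q *v \<psi>) = - (annih q *v (annih p *v \<psi>))"
proof -
  have "annih p *v (annih q *v \<psi>) + annih q *v (annih p *v \<psi>) = 0"
    by (simp add: CAR_annih matrix_vector_mul_assoc flip: matrix_vector_mult_add_rdistrib)
  then show ?thesis by (simp add: eq_neg_iff_add_eq_0)
qed

lemma create_create: "create p *v (create q *v \<psi>) = - (create q *v (create p *v \<psi>))"
proof -
  have "create p *v (create q *v \<psi>) + create q *v (create p *v \<psi>) = 0"
    by (simp add: CAR_create matrix_vector_mul_assoc flip: matrix_vector_mult_add_rdistrib)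
  then show ?thesis by (simp add: eq_neg_iff_add_eq_0)
qed

lemma matrix_vector_mult_uminus:
  fixes A :: "complex ^ 'n::finite ^ 'm::finite"
  shows "A *v (- \<psi>) = - (A *v \<psi>)"
  by (simp add: vec_eq_iff matrix_vector_mult_def sum_negf)

lemma annih_ket_unoccupied: "p \<notin> set qs \<Longrightarrow> annih p *v ket qs = 0"
  by (induction qs) (simp_all add: ket_Nil ket_Cons annih_vac annih_create)

lemma annih_ket_Cons: "p \<notin> set qs \<Longrightarrow> annih p *v ket (p # qs) = ket qs"
  by (simp add: ket_Cons annih_create annih_ket_unoccupied)

lemma op_prod_create_ket: "op_prod (map create ps) *v ket rs = ket (ps @ rs)"
  by (induction ps) (simp_all add: op_prod_Nil op_prod_Cons ket_Cons flip: matrix_vector_mul_assoc)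

text \<open>In the reversed product the rightmost annihilator belongs to the first orbital of the
  ket, so each one acts at the front and produces no sign.\<close>

lemma op_prod_annih_ket:
  "distinct (is @ rs) \<Longrightarrow> op_prod (map annih (rev is)) *v ket (is @ rs) = ket rs"
  by (induction "is")
    (simp_all add: op_prod_Nil op_prod_Cons op_prod_append annih_ket_Cons
      flip: matrix_vector_mul_assoc)

lemma annih_op_prod_annih_eq_0:
  "annih p *v \<psi> = 0 \<Longrightarrow> annih p *v (op_prod (map annih qs) *v \<psi>) = 0"
proof (induction qs)
  case (Cons q qs)
  then show ?case
    by (simp add: op_prod_Cons annih_annih[of p q] flip: matrix_vector_mul_assoc)
qed (simp add: op_prod_Nil)

lemma op_prod_annih_eq_0:
  "p \<in> set qs \<Longrightarrow> annih p *v \<psi> = 0 \<Longrightarrow> op_prod (map annih qs) *v \<psi> = 0"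
  by (induction qs)
    (auto simp: op_prod_Cons annih_op_prod_annih_eq_0 simp flip: matrix_vector_mul_assoc)

lemma excitation_ket:
  "distinct (is @ rs) \<Longrightarrow> excitation is ps *v ket (is @ rs) = ket (ps @ rs)"
  by (simp add: excitation_def op_prod_annih_ket op_prod_create_ket flip: matrix_vector_mul_assoc)

lemma excitation_ket_eq_0:
  assumes "\<not> set is \<subseteq> set qs"
  shows "excitation is ps *v ket qs = 0"
proof -
  from assms obtain i where "i \<in> set (rev is)" "i \<notin> set qs" by auto
  then have "op_prod (map annih (rev is)) *v ket qs = 0"
    using op_prod_annih_eq_0 annih_ket_unoccupied by blast
  then show ?thesis by (simp add: excitation_def flip: matrix_vector_mul_assoc)
qed

section \<open>UCC factors and controlled factors on determinants\<close>

lemma ucc_ket_rotation: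
  assumes "distinct (is @ rs)" "distinct (ps @ rs)"
    and "\<not> set ps \<subseteq> set (is @ rs)" "\<not> set is \<subseteq> set (ps @ rs)"
  shows "ucc is ps \<theta> *v ket (is @ rs) =
    complex_of_real (cos \<theta>) *s ket (is @ rs) + complex_of_real (sin \<theta>) *s ket (ps @ rs)"
  unfolding ucc_def dagger_excitation
  by (rule op_exp_rotation)
    (simp_all only: matrix_vector_mult_diff_rdistrib excitation_ket assms
      excitation_ket_eq_0 diff_0_right diff_0 not_False_eq_True)

text \<open>This is the same rotation started from its second axis: the generator sends
  \<open>ket (ps @ rs)\<close> to \<open>- ket (is @ rs)\<close>, and that in turn to
  \<open>- ket (ps @ rs)\<close>.\<close>

lemma ucc_ket_rotation_inverse:
  assumes "distinct (is @ rs)" "distinct (ps @ rs)"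
    and "\<not> set ps \<subseteq> set (is @ rs)" "\<not> set is \<subseteq> set (ps @ rs)"
  shows "ucc is ps \<theta> *v ket (ps @ rs) =
    complex_of_real (cos \<theta>) *s ket (ps @ rs) - complex_of_real (sin \<theta>) *s ket (is @ rs)"
proof -
  have "ucc is ps \<theta> *v ket (ps @ rs) =
    complex_of_real (cos \<theta>) *s ket (ps @ rs) + complex_of_real (sin \<theta>) *s (- ket (is @ rs))"
    unfolding ucc_def dagger_excitation
    by (rule op_exp_rotation)
      (simp_all only: matrix_vector_mult_diff_rdistrib matrix_vector_mult_uminus excitation_ket
        assms excitation_ket_eq_0 diff_0_right diff_0 not_False_eq_True)
  then show ?thesis by simp
qed

lemma ucc_ket_fixed:
  assumes "\<not> set is \<subseteq> set qs" "\<not> set ps \<subseteq> set qs"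
  shows "ucc is ps \<theta> *v ket qs = ket qs"
  unfolding ucc_def dagger_excitation
  by (rule op_exp_fixed) (simp add: matrix_vector_mult_diff_rdistrib excitation_ket_eq_0 assms)

text \<open>This links kets to the occupation basis, in which \<open>cucc\<close> is defined column
  by column. The factor is zero when an orbital repeats.\<close>

lemma ket_eq_axis:
  obtains k where "ket ps = k *s axis (set ps) 1"
proof -
  have "\<exists>k. ket ps = k *s axis (set ps) 1"
  proof (induction ps)
    case Nil
    then show ?case by (intro exI[of _ 1]) (simp add: ket_Nil vac_def)
  next
    case (Cons p ps)
    then obtain k where "ket ps = k *s axis (set ps) 1" by blast
    then have "ket (p # ps) = (if p \<in> set ps then 0 else k * jw_sign p (set ps)) *s
        axis (set (p # ps)) 1"
      by (simp add: ket_Cons vector_scalar_commute create_axis)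
    then show ?case by blast
  qed
  then show ?thesis using that by blast
qed

lemma cucc_ket:
  "cucc qs is ps \<theta> *v ket rs = (if set qs \<subseteq> set rs then ucc is ps \<theta> *v ket rs else ket rs)"
proof -
  have "cucc qs is ps \<theta> *v axis S 1 =
      (if set qs \<subseteq> S then ucc is ps \<theta> else mat 1) *v axis S 1" for S
    unfolding vec_eq_iff mult_axis_nth by (simp add: cucc_def)
  then show ?thesis
    by (rule_tac ket_eq_axis[of rs]) (simp add: vector_scalar_commute)
qed

section \<open>Signs from reordering orbitals\<close>

lemma ket_swap: "ket (p # q # rs) = - ket (q # p # rs)"
  unfolding ket_Cons by (rule create_create)

lemma ket_append_Cons: "ket (ps @ q # rs) = (- 1) ^ length ps *s ket (q # ps @ rs)"
proof (induction ps)
  case (Cons p ps)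
  have "ket ((p # ps) @ q # rs) = (- 1) ^ length ps *s ket (p # q # ps @ rs)"
    using Cons by (simp add: ket_Cons[of p] vector_scalar_commute)
  then show ?case by (simp add: ket_swap[of p])
qed simp

text \<open>Each orbital of \<open>qs\<close> passes every orbital of \<open>ps\<close> once, and
  each passage contributes a factor -1.\<close>

lemma ket_append_commute:
  "ket (ps @ qs @ rs) = (- 1) ^ (length ps * length qs) *s ket (qs @ ps @ rs)"
proof (induction qs)
  case (Cons q qs)
  have "ket (ps @ (q # qs) @ rs) = (- 1) ^ length ps *s (create q *v ket (ps @ qs @ rs))"
    using ket_append_Cons[of ps q "qs @ rs"] by (simp only: append_Cons ket_Cons)
  also have "\<dots> = ((- 1) ^ length ps * (- 1) ^ (length ps * length qs)) *s
      (create q *v ket (qs @ ps @ rs))"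
    unfolding Cons by (simp only: vector_scalar_commute vector_smult_assoc)
  also have "\<dots> = (- 1) ^ (length ps * length (q # qs)) *s ket ((q # qs) @ ps @ rs)"
    by (simp only: list.size(4) power_add mult_Suc_right append_Cons ket_Cons One_nat_def
        add_Suc_right add_0_right)
  finally show ?case .
qed simp

theorem mainTheorem4:
  fixes a b c d e f u v w x y z \<eta>1 \<eta>2 \<phi>1 \<phi>2 \<phi>3 \<phi>4 \<phi>5 \<phi>6 :: "'o::{finite,linorder}"
    and \<theta> :: real
    and \<xi>1 \<xi>2 \<xi>3 \<xi>4 :: complex
    and \<Psi> :: "'o fock"
  assumes "distinct [a, b, c, d, e, f, u, v, w, x, y, z, \<eta>1, \<eta>2]"
    and "{\<phi>1, \<phi>2, \<phi>3, \<phi>4, \<phi>5, \<phi>6} \<inter> {a, b, c, d, e, f, u, v, w, x, y, z, \<eta>1, \<eta>2} = {}"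
    and "distinct [\<phi>1, \<phi>2, \<phi>3, \<phi>4]"
    and "\<phi>5 \<noteq> \<phi>6"
    and "\<Psi> = \<xi>1 *s ket [a, b, c, d, e, f] + \<xi>2 *s ket [a, b, \<phi>1, \<phi>2, \<phi>3, \<phi>4]
            + \<xi>3 *s ket [c, d, e, f, \<phi>5, \<phi>6] + \<xi>4 *s ket [u, v, w, x, y, z]"
  shows "(ucc [u, \<eta>1] [a, b] (pi / 2) ** ucc [w, x, y, \<eta>2] [c, d, e, f] (pi / 2)
           ** cucc [u, w, x, y] [\<eta>1, \<eta>2] [v, z] \<theta>
           ** ucc [c, d, e, f] [w, x, y, \<eta>2] (pi / 2) ** ucc [a, b] [u, \<eta>1] (pi / 2)) *v \<Psi>
         = op_exp (\<theta> *\<^sub>R (excitation [a, b, c, d, e, f] [u, v, w, x, y, z]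
                       - dagger (excitation [a, b, c, d, e, f] [u, v, w, x, y, z]))) *v \<Psi>
       \<and> op_exp (\<theta> *\<^sub>R (excitation [a, b, c, d, e, f] [u, v, w, x, y, z]
                     - dagger (excitation [a, b, c, d, e, f] [u, v, w, x, y, z]))) *v \<Psi>
         = \<xi>1 *s (complex_of_real (cos \<theta>) *s ket [a, b, c, d, e, f]
                  + complex_of_real (sin \<theta>) *s ket [u, v, w, x, y, z])
           + \<xi>2 *s ket [a, b, \<phi>1, \<phi>2, \<phi>3, \<phi>4]
           + \<xi>3 *s ket [c, d, e, f, \<phi>5, \<phi>6]
           + \<xi>4 *s (complex_of_real (cos \<theta>) *s ket [u, v, w, x, y, z]
                  - complex_of_real (sin \<theta>) *s ket [a, b, c, d, e, f])"
proof -
  have "\<forall>p \<in> {\<phi>1, \<phi>2, \<phi>3, \<phi>4, \<phi>5, \<phi>6}.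
      \<forall>q \<in> {a, b, c, d, e, f, u, v, w, x, y, z, \<eta>1, \<eta>2}. p \<noteq> q \<and> q \<noteq> p"
    using assms(2) by blast
  \<comment> \<open>The reversed lists supply the inequalities in the other orientation, which the simplifier does
    not derive by itself.\<close>
  note D = this[simplified] assms(4) not_sym[OF assms(4)] assms(1,3)[simplified]
    distinct_rev[THEN iffD2, OF assms(1), unfolded rev.simps append.simps, simplified]
    distinct_rev[THEN iffD2, OF assms(3), unfolded rev.simps append.simps, simplified]

  \<comment> \<open>Moving \<open>p\<close> past \<open>u\<close> costs one sign, and moving
    \<open>q\<close> past four orbitals costs none. The sign is the same for \<eta>1, \<eta>2 as for
    \<open>v\<close>, \<open>z\<close>, so it cancels in the controlled rotation.\<close>
  have pull: "ket [u, p, w, x, y, q] = - ket [p, q, u, w, x, y]" for p q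
    using ket_append_commute[of "[u]" "[p]" "[w, x, y, q]"]
      ket_append_commute[of "[u, w, x, y]" "[q]" "[]"]
    by (simp add: ket_Cons[of p] matrix_vector_mult_uminus)
  \<comment> \<open>A pair passes four orbitals in eight transpositions, an even number.\<close>
  have comm: "ket [p, q, r1, r2, r3, r4] = ket [r1, r2, r3, r4, p, q]" for p q r1 r2 r3 r4
    using ket_append_commute[of "[p, q]" "[r1, r2, r3, r4]" "[]"] by simp

  let ?A = "ucc [a, b] [u, \<eta>1] (pi / 2)" and ?B = "ucc [c, d, e, f] [w, x, y, \<eta>2] (pi / 2)"
  let ?C = "cucc [u, w, x, y] [\<eta>1, \<eta>2] [v, z] \<theta>"
  let ?B' = "ucc [w, x, y, \<eta>2] [c, d, e, f] (pi / 2)" and ?A' = "ucc [u, \<eta>1] [a, b] (pi / 2)"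
  let ?U = "ucc [a, b, c, d, e, f] [u, v, w, x, y, z] \<theta>"

  \<comment> \<open>At \<open>pi / 2\<close> the cosine vanishes and the sine is 1, so a rotation
    becomes a plain replacement of orbitals. The last two kets are fixed: each lacks an orbital of
    both index lists.\<close>
  have A: "?A *v ket [a, b, c, d, e, f] = ket [u, \<eta>1, c, d, e, f]"
    "?A *v ket [a, b, \<phi>1, \<phi>2, \<phi>3, \<phi>4] = ket [u, \<eta>1, \<phi>1, \<phi>2, \<phi>3, \<phi>4]"
    "?A *v ket [c, d, e, f, \<phi>5, \<phi>6] = ket [c, d, e, f, \<phi>5, \<phi>6]"
    "?A *v ket [u, v, w, x, y, z] = ket [u, v, w, x, y, z]"
    using ucc_ket_rotation[of "[a, b]" "[c, d, e, f]" "[u, \<eta>1]" "pi / 2"]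
      ucc_ket_rotation[of "[a, b]" "[\<phi>1, \<phi>2, \<phi>3, \<phi>4]" "[u, \<eta>1]" "pi / 2"] D
    by (simp_all add: D ucc_ket_fixed)
  have B: "?B *v ket [u, \<eta>1, c, d, e, f] = ket [u, \<eta>1, w, x, y, \<eta>2]"
    "?B *v ket [u, \<eta>1, \<phi>1, \<phi>2, \<phi>3, \<phi>4] = ket [u, \<eta>1, \<phi>1, \<phi>2, \<phi>3, \<phi>4]"
    "?B *v ket [c, d, e, f, \<phi>5, \<phi>6] = ket [w, x, y, \<eta>2, \<phi>5, \<phi>6]"
    "?B *v ket [u, v, w, x, y, z] = ket [u, v, w, x, y, z]"
    using ucc_ket_rotation[of "[c, d, e, f]" "[u, \<eta>1]" "[w, x, y, \<eta>2]" "pi / 2"]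
      ucc_ket_rotation[of "[c, d, e, f]" "[\<phi>5, \<phi>6]" "[w, x, y, \<eta>2]" "pi / 2"] D
    by (simp_all add: D comm[of u \<eta>1] ucc_ket_fixed)
  \<comment> \<open>The second and third kets are fixed because the controls \<open>w\<close> and
    \<open>u\<close>, respectively, are empty in them.\<close>
  have C: "?C *v ket [u, \<eta>1, w, x, y, \<eta>2] =
      complex_of_real (cos \<theta>) *s ket [u, \<eta>1, w, x, y, \<eta>2]
      + complex_of_real (sin \<theta>) *s ket [u, v, w, x, y, z]"
    "?C *v ket [u, \<eta>1, \<phi>1, \<phi>2, \<phi>3, \<phi>4] = ket [u, \<eta>1, \<phi>1, \<phi>2, \<phi>3, \<phi>4]"
    "?C *v ket [w, x, y, \<eta>2, \<phi>5, \<phi>6] = ket [w, x, y, \<eta>2, \<phi>5, \<phi>6]"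
    "?C *v ket [u, v, w, x, y, z] =
      complex_of_real (cos \<theta>) *s ket [u, v, w, x, y, z]
      - complex_of_real (sin \<theta>) *s ket [u, \<eta>1, w, x, y, \<eta>2]"
    using ucc_ket_rotation[of "[\<eta>1, \<eta>2]" "[u, w, x, y]" "[v, z]" \<theta>]
      ucc_ket_rotation_inverse[of "[\<eta>1, \<eta>2]" "[u, w, x, y]" "[v, z]" \<theta>]
    by (simp_all add: D cucc_ket pull matrix_vector_mult_uminus)
  \<comment> \<open>The inverse rotation is written with exchanged index lists rather than a
    negative angle, so the kets to be restored again lie on the first axis and acquire no minus
    sign. In \<open>|uvwxyz>\<close> the orbital \<eta>2 is empty, so it stays fixed.\<close>
  have B': "?B' *v ket [u, \<eta>1, w, x, y, \<eta>2] = ket [u, \<eta>1, c, d, e, f]"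
    "?B' *v ket [u, \<eta>1, \<phi>1, \<phi>2, \<phi>3, \<phi>4] = ket [u, \<eta>1, \<phi>1, \<phi>2, \<phi>3, \<phi>4]"
    "?B' *v ket [w, x, y, \<eta>2, \<phi>5, \<phi>6] = ket [c, d, e, f, \<phi>5, \<phi>6]"
    "?B' *v ket [u, v, w, x, y, z] = ket [u, v, w, x, y, z]"
    using ucc_ket_rotation[of "[w, x, y, \<eta>2]" "[u, \<eta>1]" "[c, d, e, f]" "pi / 2"]
      ucc_ket_rotation[of "[w, x, y, \<eta>2]" "[\<phi>5, \<phi>6]" "[c, d, e, f]" "pi / 2"] D
    by (simp_all add: D comm[of u \<eta>1] ucc_ket_fixed)
  have A': "?A' *v ket [u, \<eta>1, c, d, e, f] = ket [a, b, c, d, e, f]"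
    "?A' *v ket [u, \<eta>1, \<phi>1, \<phi>2, \<phi>3, \<phi>4] = ket [a, b, \<phi>1, \<phi>2, \<phi>3, \<phi>4]"
    "?A' *v ket [c, d, e, f, \<phi>5, \<phi>6] = ket [c, d, e, f, \<phi>5, \<phi>6]"
    "?A' *v ket [u, v, w, x, y, z] = ket [u, v, w, x, y, z]"
    using ucc_ket_rotation[of "[u, \<eta>1]" "[c, d, e, f]" "[a, b]" "pi / 2"]
      ucc_ket_rotation[of "[u, \<eta>1]" "[\<phi>1, \<phi>2, \<phi>3, \<phi>4]" "[a, b]" "pi / 2"] D
    by (simp_all add: D ucc_ket_fixed)
  have U: "?U *v ket [a, b, c, d, e, f] =
      complex_of_real (cos \<theta>) *s ket [a, b, c, d, e, f]
      + complex_of_real (sin \<theta>) *s ket [u, v, w, x, y, z]"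
    "?U *v ket [a, b, \<phi>1, \<phi>2, \<phi>3, \<phi>4] = ket [a, b, \<phi>1, \<phi>2, \<phi>3, \<phi>4]"
    "?U *v ket [c, d, e, f, \<phi>5, \<phi>6] = ket [c, d, e, f, \<phi>5, \<phi>6]"
    "?U *v ket [u, v, w, x, y, z] =
      complex_of_real (cos \<theta>) *s ket [u, v, w, x, y, z]
      - complex_of_real (sin \<theta>) *s ket [a, b, c, d, e, f]"
    using ucc_ket_rotation[of "[a, b, c, d, e, f]" "[]" "[u, v, w, x, y, z]" \<theta>]
      ucc_ket_rotation_inverse[of "[a, b, c, d, e, f]" "[]" "[u, v, w, x, y, z]" \<theta>]
    by (simp_all add: D ucc_ket_fixed)

  note lin = matrix_vector_right_distrib matrix_vector_mult_diff_distrib vector_scalar_commute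
  \<comment> \<open>By linearity, the images of the four determinants, followed through the five
    factors from right to left, settle both equations.\<close>
  show ?thesis
    unfolding ucc_def[symmetric] assms(5)
    by (simp only: lin A B C B' A' U simp_thms flip: matrix_vector_mul_assoc)
qed

end
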